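(* Let $S$ be a monoid. Then the following conditions are equivalent: (i) All cyclic $S$-acts are Hopfian and co-Hopfian. (ii) All cyclic $S$-acts are Fitting. (iii) All cyclic $S$-acts are strongly Hopfian and strongly co-Hopfian.
   Context: $S$-acts are unitary right acts (nonempty sets) over the monoid $S$; natural numbers are positive integers. An $S$-act $A$ is cyclic if $A=aS$ for some $a\in A$. $\mathrm{End}(A)$ is the set of $S$-endomorphisms of $A$. $\Delta_A=\{(a,a)\mid a\in A\}$ and $\bigtriangledown_A=A\times A$. For a subact $B$ of $A$, the Rees congruence is $\rho_B=(B\times B)\cup\Delta_A$. For $f\in \mathrm{End}(A)$, $\ker f=\{(a,b)\in A\times A\mid f(a)=f(b)\}$, and $\mathcal{K}_{\mathrm{Im} f^n}=\rho_{\mathrm{Im} f^n}$. The join $\vee$ is taken in the lattice of congruences on $A$. $A$ is Hopfian (resp. co-Hopfian) if every surjective (resp. injective) endomorphism of $A$ is an automorphism. $A$ is strongly Hopfian (resp. strongly co-Hopfian) if for every $f\in\mathrm{End}(A)$ the ascending chain $\ker f\subseteq\ker f^2\subseteq\cdots$ (resp. the descending chain $\mathrm{Im} f\supseteq \mathrm{Im} f^2\supseteq\cdots$) is stationary. $A$ is a Fitting act if for every $f\in\mathrm{End}(A)$ there exists a natural number $n$ such that $\ker f^n\vee\mathcal{K}_{\mathrm{Im} f^n}=\bigtriangledown_A$ and $\ker f^n\cap\mathcal{K}_{\mathrm{Im} f^n}=\Delta_A$. *)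

theory Defs
  imports "HOL-Algebra.Group"
begin

record ('a, 's) ract = "'a partial_object" +
  smult :: "'a \<Rightarrow> 's \<Rightarrow> 'a" (infixl \<open>\<odot>\<index>\<close> 70)

locale right_act = monoid S for S :: "('s, 'm) monoid_scheme" (structure)
  and A :: "('a, 's, 'n) ract_scheme" (structure) +
  assumes nonempty: "carrier A \<noteq> {}"
    and smult_closed: "\<lbrakk>a \<in> carrier A; s \<in> carrier S\<rbrakk> \<Longrightarrow> a \<odot>\<^bsub>A\<^esub> s \<in> carrier A"
    and smult_one: "a \<in> carrier A \<Longrightarrow> a \<odot>\<^bsub>A\<^esub> \<one>\<^bsub>S\<^esub> = a"
    and smult_mult: "\<lbrakk>a \<in> carrier A; s \<in> carrier S; t \<in> carrier S\<rbrakk>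
      \<Longrightarrow> a \<odot>\<^bsub>A\<^esub> (s \<otimes>\<^bsub>S\<^esub> t) = (a \<odot>\<^bsub>A\<^esub> s) \<odot>\<^bsub>A\<^esub> t"

definition cyclic_act :: "('s, 'm) monoid_scheme \<Rightarrow> ('a, 's, 'n) ract_scheme \<Rightarrow> bool" where
  "cyclic_act S A \<longleftrightarrow> right_act S A \<and>
     (\<exists>a\<in>carrier A. carrier A = (\<lambda>s. a \<odot>\<^bsub>A\<^esub> s) ` carrier S)"

definition act_hom ::
  "('s, 'm) monoid_scheme \<Rightarrow> ('a, 's, 'n) ract_scheme \<Rightarrow> ('b, 's, 'k) ract_scheme \<Rightarrow> ('a \<Rightarrow> 'b) set"
  where "act_hom S A B = {f \<in> carrier A \<rightarrow> carrier B.
     \<forall>a\<in>carrier A. \<forall>s\<in>carrier S. f (a \<odot>\<^bsub>A\<^esub> s) = f a \<odot>\<^bsub>B\<^esub> s}"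

text \<open>Endomorphisms are total HOL functions whose values off the carrier are irrelevant: every
  notion below restricts to the carrier. The power \<open>f ^^ n\<close> is iterated composition.\<close>

definition act_End :: "('s, 'm) monoid_scheme \<Rightarrow> ('a, 's, 'n) ract_scheme \<Rightarrow> ('a \<Rightarrow> 'a) set" where
  "act_End S A = act_hom S A A"

definition act_Aut :: "('s, 'm) monoid_scheme \<Rightarrow> ('a, 's, 'n) ract_scheme \<Rightarrow> ('a \<Rightarrow> 'a) set" where
  "act_Aut S A = {f \<in> act_End S A. bij_betw f (carrier A) (carrier A)}"

definition act_ker :: "('a, 's, 'n) ract_scheme \<Rightarrow> ('a \<Rightarrow> 'a) \<Rightarrow> ('a \<times> 'a) set" where
  "act_ker A f = {(a, b) \<in> carrier A \<times> carrier A. f a = f b}"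

definition act_Im :: "('a, 's, 'n) ract_scheme \<Rightarrow> ('a \<Rightarrow> 'a) \<Rightarrow> 'a set" where
  "act_Im A f = f ` carrier A"

definition act_congruence ::
  "('s, 'm) monoid_scheme \<Rightarrow> ('a, 's, 'n) ract_scheme \<Rightarrow> ('a \<times> 'a) set \<Rightarrow> bool" where
  "act_congruence S A r \<longleftrightarrow> equiv (carrier A) r \<and>
     (\<forall>(a, b)\<in>r. \<forall>s\<in>carrier S. (a \<odot>\<^bsub>A\<^esub> s, b \<odot>\<^bsub>A\<^esub> s) \<in> r)"

definition congruence_join ::
  "('s, 'm) monoid_scheme \<Rightarrow> ('a, 's, 'n) ract_scheme \<Rightarrow> ('a \<times> 'a) set \<Rightarrow> ('a \<times> 'a) set
    \<Rightarrow> ('a \<times> 'a) set" where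
  "congruence_join S A r q = \<Inter> {t. act_congruence S A t \<and> r \<subseteq> t \<and> q \<subseteq> t}"

definition rees_congruence :: "('a, 's, 'n) ract_scheme \<Rightarrow> 'a set \<Rightarrow> ('a \<times> 'a) set" where
  "rees_congruence A B = B \<times> B \<union> Id_on (carrier A)"

definition hopfian :: "('s, 'm) monoid_scheme \<Rightarrow> ('a, 's, 'n) ract_scheme \<Rightarrow> bool" where
  "hopfian S A \<longleftrightarrow> (\<forall>f\<in>act_End S A. f ` carrier A = carrier A \<longrightarrow> f \<in> act_Aut S A)"

definition co_hopfian :: "('s, 'm) monoid_scheme \<Rightarrow> ('a, 's, 'n) ract_scheme \<Rightarrow> bool" where
  "co_hopfian S A \<longleftrightarrow> (\<forall>f\<in>act_End S A. inj_on f (carrier A) \<longrightarrow> f \<in> act_Aut S A)"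

definition strongly_hopfian :: "('s, 'm) monoid_scheme \<Rightarrow> ('a, 's, 'n) ract_scheme \<Rightarrow> bool" where
  "strongly_hopfian S A \<longleftrightarrow> (\<forall>f\<in>act_End S A.
     \<exists>n\<ge>1. \<forall>m\<ge>n. act_ker A (f ^^ m) = act_ker A (f ^^ n))"

definition strongly_co_hopfian :: "('s, 'm) monoid_scheme \<Rightarrow> ('a, 's, 'n) ract_scheme \<Rightarrow> bool" where
  "strongly_co_hopfian S A \<longleftrightarrow> (\<forall>f\<in>act_End S A.
     \<exists>n\<ge>1. \<forall>m\<ge>n. act_Im A (f ^^ m) = act_Im A (f ^^ n))"

definition fitting_act :: "('s, 'm) monoid_scheme \<Rightarrow> ('a, 's, 'n) ract_scheme \<Rightarrow> bool" where
  "fitting_act S A \<longleftrightarrow> (\<forall>f\<in>act_End S A. \<exists>n\<ge>1.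
     congruence_join S A (act_ker A (f ^^ n)) (rees_congruence A (act_Im A (f ^^ n)))
       = carrier A \<times> carrier A \<and>
     act_ker A (f ^^ n) \<inter> rees_congruence A (act_Im A (f ^^ n)) = Id_on (carrier A))"

lemma (in right_act) act_congruence_join:
  assumes "act_congruence S A r" and "act_congruence S A q"
  shows "act_congruence S A (congruence_join S A r q)"
    and "r \<subseteq> congruence_join S A r q" and "q \<subseteq> congruence_join S A r q"
    and "\<lbrakk>act_congruence S A t; r \<subseteq> t; q \<subseteq> t\<rbrakk> \<Longrightarrow> congruence_join S A r q \<subseteq> t"
proof -
  have top: "act_congruence S A (carrier A \<times> carrier A)"
    by (auto simp: act_congruence_def equiv_def refl_on_def sym_def trans_def smult_closed)
  have sub: "r \<subseteq> carrier A \<times> carrier A" "q \<subseteq> carrier A \<times> carrier A"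
    using assms by (auto simp: act_congruence_def equiv_def)
  let ?T = "{t. act_congruence S A t \<and> r \<subseteq> t \<and> q \<subseteq> t}"
  have mem: "carrier A \<times> carrier A \<in> ?T" using top sub by blast
  have eqv: "equiv (carrier A) t" if "t \<in> ?T" for t
    using that by (simp add: act_congruence_def)
  have "equiv (carrier A) (\<Inter> ?T)"
  proof (rule equivI)
    show "\<Inter> ?T \<subseteq> carrier A \<times> carrier A" using mem by blast
    show "refl_on (carrier A) (\<Inter> ?T)"
    proof (rule refl_onI)
      fix x assume "x \<in> carrier A"
      then show "(x, x) \<in> \<Inter> ?T" using eqv by (meson InterI equivE refl_onD)
    qed
    show "sym (\<Inter> ?T)"
    proof (rule symI)
      fix x y assume "(x, y) \<in> \<Inter> ?T"
      then show "(y, x) \<in> \<Inter> ?T" using eqv by (meson InterD InterI equivE symD)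
    qed
    show "trans (\<Inter> ?T)"
    proof (rule transI)
      fix x y z assume "(x, y) \<in> \<Inter> ?T" "(y, z) \<in> \<Inter> ?T"
      then show "(x, z) \<in> \<Inter> ?T" using eqv by (meson InterD InterI equivE transD)
    qed
  qed
  moreover have "(x \<odot>\<^bsub>A\<^esub> s, y \<odot>\<^bsub>A\<^esub> s) \<in> \<Inter> ?T"
    if "(x, y) \<in> \<Inter> ?T" and "s \<in> carrier S" for x y s
  proof (rule InterI)
    fix t assume t: "t \<in> ?T"
    then have "(x, y) \<in> t" using that(1) by (rule InterD[rotated])
    then show "(x \<odot>\<^bsub>A\<^esub> s, y \<odot>\<^bsub>A\<^esub> s) \<in> t"
      using t that(2) by (auto simp: act_congruence_def)
  qed
  ultimately show "act_congruence S A (congruence_join S A r q)"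
    unfolding congruence_join_def by (subst act_congruence_def) blast
  show "r \<subseteq> congruence_join S A r q" "q \<subseteq> congruence_join S A r q"
    by (auto simp: congruence_join_def)
  show "\<lbrakk>act_congruence S A t; r \<subseteq> t; q \<subseteq> t\<rbrakk> \<Longrightarrow> congruence_join S A r q \<subseteq> t"
    by (auto simp: congruence_join_def)
qed

text \<open>Quantifying over all cyclic acts in one HOL type loses nothing if the type is large enough:
  every cyclic \<open>S\<close>-act, over whatever type, is isomorphic to one over the element type of \<open>S\<close>.\<close>

lemma cyclic_act_representable:
  fixes S :: "('s, 'm) monoid_scheme" and A :: "('a, 's) ract"
  assumes "cyclic_act S A"
  shows "\<exists>(B :: ('s, 's) ract) h. cyclic_act S B \<and> h \<in> act_hom S A B \<and>
    bij_betw h (carrier A) (carrier B)"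
proof -
  interpret right_act S A using assms by (simp add: cyclic_act_def)
  obtain a where a: "a \<in> carrier A" and gen: "carrier A = (\<lambda>s. a \<odot>\<^bsub>A\<^esub> s) ` carrier S"
    using assms by (auto simp: cyclic_act_def)
  define h where "h = inv_into (carrier S) (\<lambda>s. a \<odot>\<^bsub>A\<^esub> s)"
  have inj: "inj_on h (carrier A)"
    unfolding h_def gen by (rule inj_on_inv_into) simp
  define g where "g = inv_into (carrier A) h"
  have gh: "g (h x) = x" if "x \<in> carrier A" for x
    using inj that by (simp add: g_def)
  define B :: "('s, 's) ract" where
    "B = \<lparr>carrier = h ` carrier A, smult = (\<lambda>x s. h (g x \<odot>\<^bsub>A\<^esub> s))\<rparr>"
  have cB: "carrier B = h ` carrier A" and sB: "\<And>x s. x \<odot>\<^bsub>B\<^esub> s = h (g x \<odot>\<^bsub>A\<^esub> s)"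
    by (simp_all add: B_def)
  have rB: "right_act S B"
  proof unfold_locales
    show "carrier B \<noteq> {}" using nonempty by (simp add: cB)
  next
    fix x s assume "x \<in> carrier B" "s \<in> carrier S"
    then show "x \<odot>\<^bsub>B\<^esub> s \<in> carrier B" by (auto simp: cB sB gh smult_closed)
  next
    fix x assume "x \<in> carrier B"
    then show "x \<odot>\<^bsub>B\<^esub> \<one>\<^bsub>S\<^esub> = x" by (auto simp: cB sB gh smult_one)
  next
    fix x s t assume "x \<in> carrier B" "s \<in> carrier S" "t \<in> carrier S"
    then show "x \<odot>\<^bsub>B\<^esub> (s \<otimes>\<^bsub>S\<^esub> t) = (x \<odot>\<^bsub>B\<^esub> s) \<odot>\<^bsub>B\<^esub> t"
      by (auto simp: cB sB gh smult_closed smult_mult)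
  qed
  have "carrier B = (\<lambda>s. h a \<odot>\<^bsub>B\<^esub> s) ` carrier S"
    unfolding sB gh[OF a] cB by (subst gen) (simp add: image_image)
  then have "cyclic_act S B" using rB a unfolding cyclic_act_def cB by blast
  moreover have "h \<in> act_hom S A B" by (auto simp: act_hom_def cB sB gh)
  moreover have "bij_betw h (carrier A) (carrier B)" using inj by (simp add: bij_betw_def cB)
  ultimately show ?thesis by blast
qed

end

theory Submission
  imports Defs
begin

text \<open>All three conditions are reduced to one: for every endomorphism \<open>f\<close> of a cyclic act \<open>A\<close>
  some power of \<open>f\<close> has an image on which \<open>f\<close> restricts to a bijection. For a single act this is
  equivalent to being Fitting, because the join of a kernel with the Rees congruence of the image
  of \<open>g\<close> is total precisely if \<open>g\<close> maps its image onto itself, and their intersection is trivial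
  precisely if \<open>g\<close> is injective there; it is also equivalent to being
  strongly Hopfian and strongly co-Hopfian. To reach it from the Hopfian properties, let
  \<open>A = aS\<close> and divide \<open>A\<close> by the union of all \<open>ker f\<^sup>n\<close>. The induced endomorphism is injective, hence
  surjective as the quotient is co-Hopfian, so \<open>f\<^sup>n(a) = f\<^sup>n\<^sup>+\<^sup>1(b)\<close> for some \<open>n\<close> and \<open>b\<close>. Therefore
  \<open>f\<close> maps the cyclic subact \<open>Im f\<^sup>n\<close> onto itself, and bijectively as that subact is Hopfian.\<close>

section \<open>Endomorphisms and their powers\<close>

lemma (in right_act) act_End_closed:
  assumes "f \<in> act_End S A" and "x \<in> carrier A"
  shows "f x \<in> carrier A"
  using assms by (auto simp: act_End_def act_hom_def)

lemma (in right_act) act_End_smult: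
  assumes "f \<in> act_End S A" and "x \<in> carrier A" and "s \<in> carrier S"
  shows "f (x \<odot>\<^bsub>A\<^esub> s) = f x \<odot>\<^bsub>A\<^esub> s"
  using assms by (auto simp: act_End_def act_hom_def)

lemma (in right_act) act_End_funpow:
  assumes "f \<in> act_End S A"
  shows "f ^^ n \<in> act_End S A"
proof (induction n)
  case 0
  show ?case by (simp add: act_End_def act_hom_def)
next
  case (Suc n)
  show ?case
    using act_End_closed[OF assms] act_End_smult[OF assms]
      act_End_closed[OF Suc] act_End_smult[OF Suc]
    by (auto simp: act_End_def act_hom_def)
qed

section \<open>The Fitting condition for a single act\<close>

text \<open>Off the diagonal the Rees congruence contains only pairs of image points, so the
  intersection exceeds the diagonal exactly by the pairs of distinct image points that
  \<open>g\<close> identifies.\<close>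

lemma (in right_act) act_ker_Int_rees_eq_Id_iff:
  assumes "g \<in> act_End S A"
  shows "act_ker A g \<inter> rees_congruence A (act_Im A g) = Id_on (carrier A)
    \<longleftrightarrow> inj_on g (g ` carrier A)"
proof -
  have "act_ker A g \<inter> rees_congruence A (act_Im A g)
      = Id_on (carrier A) \<union> {(x, y) \<in> g ` carrier A \<times> g ` carrier A. g x = g y}"
    using act_End_closed[OF assms] by (auto simp: act_ker_def rees_congruence_def act_Im_def)
  moreover have "{(x, y) \<in> B \<times> B. g x = g y} \<subseteq> Id_on (carrier A) \<longleftrightarrow> inj_on g B"
    if "B \<subseteq> carrier A" for B
    using that by (auto simp: inj_on_def)
  moreover have "g ` carrier A \<subseteq> carrier A" using act_End_closed[OF assms] by auto
  ultimately show ?thesis by (simp add: subset_Un_eq Un_commute)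
qed

text \<open>Necessity comes from one explicit congruence above both relations. For sufficiency,
  every point is kernel-related to a point of the image, and any two image points are
  Rees-related.\<close>

lemma (in right_act) join_ker_rees_eq_top_iff:
  assumes g: "g \<in> act_End S A"
  shows "congruence_join S A (act_ker A g) (rees_congruence A (act_Im A g))
      = carrier A \<times> carrier A \<longleftrightarrow> g ` g ` carrier A = g ` carrier A"
    (is "?J = ?top \<longleftrightarrow> _")
proof
  note closed = act_End_closed[OF g] and smult = act_End_smult[OF g]
  \<comment> \<open>The preimage under \<open>g\<close> of the Rees congruence of the image of
    \<open>g \<circ> g\<close>. It contains the Rees congruence of the image of \<open>g\<close>,
    since \<open>g\<close> sends image points into the image of \<open>g \<circ> g\<close>.\<close>
  define t where "t = {(x, y) \<in> ?top. g x = g y \<or> g x \<in> g ` g ` carrier A \<and> g y \<in> g ` g ` carrier A}"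
  assume top: "?J = ?top"
  have im_smult: "g (x \<odot>\<^bsub>A\<^esub> s) \<in> g ` g ` carrier A"
    if x: "x \<in> carrier A" and gx: "g x \<in> g ` g ` carrier A" and s: "s \<in> carrier S" for x s
  proof -
    obtain c where c: "c \<in> carrier A" "g x = g (g c)" using gx by auto
    have "g (x \<odot>\<^bsub>A\<^esub> s) = g (g (c \<odot>\<^bsub>A\<^esub> s))"
      using c x s by (simp add: smult closed smult_closed)
    then show ?thesis using c s smult_closed by auto
  qed
  have "equiv (carrier A) t"
    by (auto simp: t_def equiv_def refl_on_def sym_def trans_def)
  moreover have "(x \<odot>\<^bsub>A\<^esub> s, y \<odot>\<^bsub>A\<^esub> s) \<in> t" if "(x, y) \<in> t" "s \<in> carrier S" for x y s
  proof -
    have xy: "x \<in> carrier A" "y \<in> carrier A"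
      and "g x = g y \<or> g x \<in> g ` g ` carrier A \<and> g y \<in> g ` g ` carrier A"
      using that(1) by (simp_all add: t_def)
    then have "g (x \<odot>\<^bsub>A\<^esub> s) = g (y \<odot>\<^bsub>A\<^esub> s) \<or>
        g (x \<odot>\<^bsub>A\<^esub> s) \<in> g ` g ` carrier A \<and> g (y \<odot>\<^bsub>A\<^esub> s) \<in> g ` g ` carrier A"
      using that(2) im_smult smult by metis
    then show ?thesis using xy that(2) by (simp add: t_def smult_closed)
  qed
  ultimately have "act_congruence S A t"
    by (auto simp: act_congruence_def)
  moreover have "act_ker A g \<subseteq> t" "rees_congruence A (act_Im A g) \<subseteq> t"
    using closed by (auto simp: t_def act_ker_def rees_congruence_def act_Im_def)
  ultimately have "?top \<subseteq> t" using top by (auto simp: congruence_join_def)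
  \<comment> \<open>For the pair \<open>(x, g x)\<close> either alternative in \<open>t\<close> puts
    \<open>g x\<close> into the image of \<open>g \<circ> g\<close>.\<close>
  then have "g x \<in> g ` g ` carrier A" if "x \<in> carrier A" for x
    using that closed[OF that] by (auto simp: t_def)
  then show "g ` g ` carrier A = g ` carrier A" using closed by auto
next
  note closed = act_End_closed[OF g]
  assume im: "g ` g ` carrier A = g ` carrier A"
  have "act_congruence S A ?top"
    by (auto simp: act_congruence_def equiv_def refl_on_def sym_def trans_def smult_closed)
  then have "?J \<subseteq> ?top"
    using closed unfolding congruence_join_def
    by (intro Inter_lower) (auto simp: act_ker_def rees_congruence_def act_Im_def)
  moreover have "(x, y) \<in> t"
    if xy: "x \<in> carrier A" "y \<in> carrier A" and t: "act_congruence S A t"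
      and ker: "act_ker A g \<subseteq> t" and rees: "rees_congruence A (act_Im A g) \<subseteq> t" for x y t
  proof -
    have "\<exists>c\<in>carrier A. (z, g c) \<in> t" if "z \<in> carrier A" for z
    proof -
      from that im have "g z \<in> g ` g ` carrier A" by auto
      then obtain c where "c \<in> carrier A" "g z = g (g c)" by auto
      then show ?thesis using that closed ker by (auto simp: act_ker_def)
    qed
    then obtain c d where "c \<in> carrier A" "(x, g c) \<in> t" "d \<in> carrier A" "(y, g d) \<in> t"
      using xy by meson
    moreover from this have "(g c, g d) \<in> t"
      using rees by (auto simp: rees_congruence_def act_Im_def)
    ultimately show ?thesis
      using t unfolding act_congruence_def equiv_def by (meson symD transD)
  qed
  then have "?top \<subseteq> ?J" by (auto simp: congruence_join_def)
  ultimately show "?J = ?top" by blast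
qed

lemma (in right_act) funpow_image_decreasing:
  assumes "f \<in> act_End S A" and "m \<le> n"
  shows "(f ^^ n) ` carrier A \<subseteq> (f ^^ m) ` carrier A"
proof -
  have "f ^^ n = f ^^ m \<circ> f ^^ (n - m)" using assms(2) by (simp flip: funpow_add)
  then show ?thesis using act_End_closed[OF act_End_funpow[OF assms(1)]] by auto
qed

text \<open>The two preceding criteria, applied to \<open>f ^^ n\<close>, say that
  \<open>f ^^ n\<close> permutes its own image; it remains to pass from \<open>f ^^ n\<close> to
  \<open>f\<close>.\<close>

lemma (in right_act) fitting_act_iff:
  "fitting_act S A \<longleftrightarrow> (\<forall>f\<in>act_End S A. \<exists>n\<ge>1.
     bij_betw f ((f ^^ n) ` carrier A) ((f ^^ n) ` carrier A))"
proof -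
  have "inj_on (f ^^ n) B \<and> (f ^^ n) ` B = B \<longleftrightarrow> bij_betw f B B"
    if f: "f \<in> act_End S A" and n: "n \<ge> 1" and B: "B = (f ^^ n) ` carrier A" for f n B
  proof
    assume inj: "inj_on (f ^^ n) B \<and> (f ^^ n) ` B = B"
    \<comment> \<open>Here \<open>n \<ge> 1\<close> matters: a factor \<open>f\<close> must be split
      off, whereas \<open>f ^^ 0\<close> is bijective on its image for every
      \<open>f\<close>.\<close>
    obtain k where k: "n = Suc k" using n by (cases n) auto
    have "inj_on (f ^^ k \<circ> f) B" using inj by (simp add: k funpow_Suc_right del: funpow.simps)
    then have "inj_on f B" by (rule inj_on_imageI2)
    moreover have "f ` B = (f ^^ Suc n) ` carrier A" by (simp add: B image_comp)
    \<comment> \<open>Images decrease and \<open>n < Suc n \<le> n + n\<close>, so equality of the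
      outer two images forces the middle one to agree.\<close>
    moreover have "B = (f ^^ (n + n)) ` carrier A"
      using inj by (simp add: B image_comp funpow_add)
    ultimately show "bij_betw f B B"
      using funpow_image_decreasing[OF f, of n "Suc n"]
        funpow_image_decreasing[OF f, of "Suc n" "n + n"] n B
      by (auto simp: bij_betw_def)
  next
    assume "bij_betw f B B"
    then have "bij_betw (f ^^ n) B B" by (rule bij_betw_funpow)
    then show "inj_on (f ^^ n) B \<and> (f ^^ n) ` B = B" by (simp add: bij_betw_def)
  qed
  then show ?thesis
    unfolding fitting_act_def
    by (intro ball_cong ex_cong1 conj_cong refl)
      (simp add: join_ker_rees_eq_top_iff act_ker_Int_rees_eq_Id_iff act_End_funpow conj_commute)
qed

section \<open>Chain conditions and Hopfian properties of a single act\<close>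

text \<open>Equality of consecutive kernels makes \<open>f\<close> injective on the image of
  \<open>f ^^ n\<close>, and equality of consecutive images makes it surjective there. Conversely,
  each higher power is \<open>f ^^ n\<close> followed by a bijection of its image, which changes
  neither kernel nor image.\<close>

lemma (in right_act) strongly_hopfian_and_strongly_co_hopfian_iff:
  "strongly_hopfian S A \<and> strongly_co_hopfian S A \<longleftrightarrow> (\<forall>f\<in>act_End S A. \<exists>n\<ge>1.
     bij_betw f ((f ^^ n) ` carrier A) ((f ^^ n) ` carrier A))"
    (is "?L \<longleftrightarrow> ?R")
proof
  assume L: ?L
  show ?R
  proof
    fix f assume "f \<in> act_End S A"
    then obtain p q where p: "p \<ge> 1" "\<forall>m\<ge>p. act_ker A (f ^^ m) = act_ker A (f ^^ p)"
      and q: "q \<ge> 1" "\<forall>m\<ge>q. act_Im A (f ^^ m) = act_Im A (f ^^ q)"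
      using L unfolding strongly_hopfian_def strongly_co_hopfian_def by meson
    \<comment> \<open>From this exponent on both chains are constant.\<close>
    define n where "n = max p q"
    have "act_ker A (f ^^ Suc n) = act_ker A (f ^^ n)"
      using p(2)[rule_format, of n] p(2)[rule_format, of "Suc n"] by (simp add: n_def)
    then have "inj_on f ((f ^^ n) ` carrier A)"
      by (auto simp: act_ker_def inj_on_def set_eq_iff)
    moreover have "act_Im A (f ^^ Suc n) = act_Im A (f ^^ n)"
      using q(2)[rule_format, of n] q(2)[rule_format, of "Suc n"] by (simp add: n_def)
    then have "f ` (f ^^ n) ` carrier A = (f ^^ n) ` carrier A"
      by (simp add: act_Im_def image_comp)
    ultimately have "bij_betw f ((f ^^ n) ` carrier A) ((f ^^ n) ` carrier A)"
      by (simp add: bij_betw_def)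
    moreover have "n \<ge> 1" using p(1) by (simp add: n_def)
    ultimately show "\<exists>n\<ge>1. bij_betw f ((f ^^ n) ` carrier A) ((f ^^ n) ` carrier A)"
      by blast
  qed
next
  assume R: ?R
  have "\<exists>n\<ge>1. (\<forall>m\<ge>n. act_ker A (f ^^ m) = act_ker A (f ^^ n)) \<and>
      (\<forall>m\<ge>n. act_Im A (f ^^ m) = act_Im A (f ^^ n))" if f: "f \<in> act_End S A" for f
  proof -
    obtain n where n: "n \<ge> 1" and bij: "bij_betw f ((f ^^ n) ` carrier A) ((f ^^ n) ` carrier A)"
      using R f by blast
    have "act_ker A (f ^^ m) = act_ker A (f ^^ n) \<and> act_Im A (f ^^ m) = act_Im A (f ^^ n)"
      if "m \<ge> n" for m
    proof -
      have m: "f ^^ m = f ^^ (m - n) \<circ> f ^^ n" using that by (simp flip: funpow_add)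
      have "bij_betw (f ^^ (m - n)) ((f ^^ n) ` carrier A) ((f ^^ n) ` carrier A)"
        using bij by (rule bij_betw_funpow)
      then have "inj_on (f ^^ (m - n)) ((f ^^ n) ` carrier A)"
        and "(f ^^ (m - n)) ` (f ^^ n) ` carrier A = (f ^^ n) ` carrier A"
        by (simp_all add: bij_betw_def)
      then show ?thesis
        unfolding m act_ker_def act_Im_def image_comp[symmetric]
        by (auto dest: inj_onD)
    qed
    then show ?thesis using n by blast
  qed
  then show ?L unfolding strongly_hopfian_def strongly_co_hopfian_def by meson
qed

text \<open>If \<open>f\<close> is surjective, the image of \<open>f ^^ n\<close> is all of
  \<open>A\<close>, where \<open>f\<close> is injective by assumption. If \<open>f\<close> is
  injective, so is \<open>f ^^ n\<close>, and it cancels from the equality of the images of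
  \<open>A\<close> and \<open>f(A)\<close> under \<open>f ^^ n\<close>.\<close>

lemma (in right_act) hopfian_and_co_hopfian_if_bij_on_image:
  assumes "\<forall>f\<in>act_End S A. \<exists>n\<ge>1. bij_betw f ((f ^^ n) ` carrier A) ((f ^^ n) ` carrier A)"
  shows "hopfian S A \<and> co_hopfian S A"
proof -
  have "f ` carrier A = carrier A \<longleftrightarrow> inj_on f (carrier A)" if f: "f \<in> act_End S A" for f
  proof
    obtain n where bij: "bij_betw f ((f ^^ n) ` carrier A) ((f ^^ n) ` carrier A)"
      using assms f by blast
    {
      assume "f ` carrier A = carrier A"
      then have "(f ^^ n) ` carrier A = carrier A" by (induction n) (simp_all flip: image_image)
      then show "inj_on f (carrier A)" using bij by (simp add: bij_betw_def)
    next
      assume inj: "inj_on f (carrier A)"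
      have sub: "f ` carrier A \<subseteq> carrier A" using act_End_closed[OF f] by auto
      have injn: "inj_on (f ^^ n) (carrier A)"
      proof (induction n)
        case (Suc n)
        have "inj_on (f ^^ n \<circ> f) (carrier A)"
          using inj Suc inj_on_subset sub by (intro comp_inj_on) auto
        then show ?case by (simp only: funpow_Suc_right)
      qed simp
      have "(f ^^ n) ` carrier A = (f ^^ n) ` f ` carrier A"
        using bij by (simp add: bij_betw_def image_image funpow_swap1)
      then show "f ` carrier A = carrier A"
        using inj_on_image_eq_iff[OF injn order_refl sub] by simp
    }
  qed
  then show ?thesis
    by (auto simp: hopfian_def co_hopfian_def act_Aut_def bij_betw_def)
qed

section \<open>Quotients and images of cyclic acts\<close>

text \<open>The quotient is carried by a set of class representatives, so that it has the same element
  type as \<open>A\<close>.\<close>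

lemma cyclic_act_quotient:
  fixes A :: "('a, 's) ract"
  assumes cyc: "cyclic_act S A" and cong: "act_congruence S A r"
  obtains B :: "('a, 's) ract" and h where "cyclic_act S B" "h \<in> act_hom S A B"
    "h ` carrier A = carrier B" "carrier B \<subseteq> carrier A"
    "\<And>x. x \<in> carrier A \<Longrightarrow> (h x, x) \<in> r"
    "\<And>x y. x \<in> carrier A \<Longrightarrow> y \<in> carrier A \<Longrightarrow> h x = h y \<longleftrightarrow> (x, y) \<in> r"
proof -
  interpret right_act S A using cyc by (simp add: cyclic_act_def)
  obtain a where a: "a \<in> carrier A" and gen: "carrier A = (\<lambda>s. a \<odot>\<^bsub>A\<^esub> s) ` carrier S"
    using cyc by (auto simp: cyclic_act_def)
  have eqv: "equiv (carrier A) r"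
    and smult: "\<And>x y s. (x, y) \<in> r \<Longrightarrow> s \<in> carrier S \<Longrightarrow> (x \<odot>\<^bsub>A\<^esub> s, y \<odot>\<^bsub>A\<^esub> s) \<in> r"
    using cong by (auto simp: act_congruence_def)
  define h where "h x = (SOME y. y \<in> r `` {x})" for x
  have h: "(x, h x) \<in> r" if "x \<in> carrier A" for x
    using someI[of "\<lambda>y. y \<in> r `` {x}" x] equiv_class_self[OF eqv that] by (simp add: h_def)
  have h_eq: "h x = h y \<longleftrightarrow> (x, y) \<in> r" if "x \<in> carrier A" "y \<in> carrier A" for x y
  proof
    assume "(x, y) \<in> r"
    then show "h x = h y" using equiv_class_eq[OF eqv] by (simp add: h_def)
  next
    assume "h x = h y"
    then show "(x, y) \<in> r" using h that eqv unfolding equiv_def by (metis symD transD)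
  qed
  have h_sym: "(h x, x) \<in> r" if "x \<in> carrier A" for x
    using h[OF that] eqv by (meson equivE symD)
  have hA: "h x \<in> carrier A" if "x \<in> carrier A" for x
    using h[OF that] eqv by (auto simp: equiv_def)
  have h_h: "h (h x) = h x" if "x \<in> carrier A" for x
    using h_eq h_sym hA that by blast
  have h_smult: "h (h x \<odot>\<^bsub>A\<^esub> s) = h (x \<odot>\<^bsub>A\<^esub> s)" if "x \<in> carrier A" "s \<in> carrier S" for x s
    using h_eq[of "h x \<odot>\<^bsub>A\<^esub> s" "x \<odot>\<^bsub>A\<^esub> s"] smult[OF h_sym] hA smult_closed that by simp
  \<comment> \<open>A representative times \<open>s\<close> need not be a representative, so the
    product is moved back by \<open>h\<close>; \<open>h_smult\<close> makes this independent of the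
    representative.\<close>
  define B :: "('a, 's) ract" where
    "B = \<lparr>carrier = h ` carrier A, smult = (\<lambda>x s. h (x \<odot>\<^bsub>A\<^esub> s))\<rparr>"
  have cB: "carrier B = h ` carrier A" and sB: "\<And>x s. x \<odot>\<^bsub>B\<^esub> s = h (x \<odot>\<^bsub>A\<^esub> s)"
    by (simp_all add: B_def)
  have "h (h x \<odot>\<^bsub>A\<^esub> s \<odot>\<^bsub>A\<^esub> t) = h (x \<odot>\<^bsub>A\<^esub> s \<odot>\<^bsub>A\<^esub> t)"
    if "x \<in> carrier A" "s \<in> carrier S" "t \<in> carrier S" for x s t
    using h_smult[of x "s \<otimes>\<^bsub>S\<^esub> t"] that by (simp add: smult_mult hA)
  then have "right_act S B"
    using nonempty
    by unfold_locales (auto simp: cB sB h_smult smult_closed smult_one smult_mult hA h_h)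
  moreover have "carrier B = (\<lambda>s. h a \<odot>\<^bsub>B\<^esub> s) ` carrier S"
    unfolding cB sB using a by (subst gen) (simp add: image_image h_smult)
  ultimately have "cyclic_act S B" unfolding cyclic_act_def cB using a by blast
  moreover have "h \<in> act_hom S A B" by (auto simp: act_hom_def cB sB h_smult)
  ultimately show thesis
    using hA h_sym h_eq by (intro that[of B h]) (auto simp: cB)
qed

text \<open>The image of a generator generates the image. This makes the Hopfian hypothesis
  available for the images of the powers of \<open>f\<close>.\<close>

lemma cyclic_act_image:
  fixes A :: "('a, 's) ract"
  assumes cyc: "cyclic_act S A" and g: "g \<in> act_End S A"
  shows "cyclic_act S (A\<lparr>carrier := g ` carrier A\<rparr>)"
proof -
  interpret right_act S A using cyc by (simp add: cyclic_act_def)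
  obtain a where a: "a \<in> carrier A" and gen: "carrier A = (\<lambda>s. a \<odot>\<^bsub>A\<^esub> s) ` carrier S"
    using cyc by (auto simp: cyclic_act_def)
  note closed = act_End_closed[OF g] and smult = act_End_smult[OF g]
  have "g x \<odot>\<^bsub>A\<^esub> s \<in> g ` carrier A" if "x \<in> carrier A" "s \<in> carrier S" for x s
    using that by (simp add: smult_closed flip: smult)
  then have "right_act S (A\<lparr>carrier := g ` carrier A\<rparr>)"
    using nonempty by unfold_locales (auto simp: closed smult_one smult_mult)
  moreover have "g ` carrier A = (\<lambda>s. g a \<odot>\<^bsub>A\<^esub> s) ` carrier S"
    by (subst gen) (simp add: image_image smult a)
  then have "carrier (A\<lparr>carrier := g ` carrier A\<rparr>)
      = (\<lambda>s. g a \<odot>\<^bsub>A\<lparr>carrier := g ` carrier A\<rparr>\<^esub> s) ` carrier S"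
    by simp
  moreover have "g a \<in> carrier (A\<lparr>carrier := g ` carrier A\<rparr>)" using a by simp
  ultimately show ?thesis unfolding cyclic_act_def by blast
qed

text \<open>The kernels form an ascending chain, so two pairs lying in different kernels both lie in
  the larger one, which yields transitivity.\<close>

lemma (in right_act) act_congruence_Union_ker:
  assumes f: "f \<in> act_End S A"
  shows "act_congruence S A (\<Union>n. act_ker A (f ^^ n))" (is "act_congruence S A ?r")
proof -
  have mono: "(f ^^ n) x = (f ^^ n) y" if "(f ^^ m) x = (f ^^ m) y" "m \<le> n" for m n x y
  proof -
    have "f ^^ n = f ^^ (n - m) \<circ> f ^^ m" using that(2) by (simp flip: funpow_add)
    then show ?thesis using that(1) by simp
  qed
  have "trans ?r"
  proof (rule transI)
    fix x y z assume "(x, y) \<in> ?r" "(y, z) \<in> ?r"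
    then obtain m n where mn: "(f ^^ m) x = (f ^^ m) y" "(f ^^ n) y = (f ^^ n) z"
      and "x \<in> carrier A" "z \<in> carrier A"
      by (auto simp: act_ker_def)
    moreover have "(f ^^ max m n) x = (f ^^ max m n) z"
      using mono[OF mn(1), of "max m n"] mono[OF mn(2), of "max m n"] by simp
    ultimately show "(x, z) \<in> ?r" by (auto simp: act_ker_def)
  qed
  moreover have "refl_on (carrier A) ?r" "sym ?r" "?r \<subseteq> carrier A \<times> carrier A"
    by (auto simp: refl_on_def sym_def act_ker_def intro: sym)
  ultimately have "equiv (carrier A) ?r" by (simp add: equiv_def)
  moreover have "(x \<odot>\<^bsub>A\<^esub> s, y \<odot>\<^bsub>A\<^esub> s) \<in> ?r" if xy: "(x, y) \<in> ?r" and s: "s \<in> carrier S" for x y s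
  proof -
    obtain n where "x \<in> carrier A" "y \<in> carrier A" "(f ^^ n) x = (f ^^ n) y"
      using xy by (auto simp: act_ker_def)
    then have "(x \<odot>\<^bsub>A\<^esub> s, y \<odot>\<^bsub>A\<^esub> s) \<in> act_ker A (f ^^ n)"
      using s by (simp add: act_ker_def act_End_smult[OF act_End_funpow[OF f]] smult_closed)
    then show ?thesis by blast
  qed
  ultimately show ?thesis
    unfolding act_congruence_def by (intro conjI ballI case_prodI2) auto
qed

section \<open>From the Hopfian properties to bijectivity on an image\<close>

text \<open>A single exponent suffices for all of \<open>A\<close> because the equation it comes
  from is needed only at a generator.\<close>

lemma image_stationary_if_cyclic_co_hopfian:
  fixes A :: "('a, 's) ract"
  assumes co: "\<forall>B :: ('a, 's) ract. cyclic_act S B \<longrightarrow> co_hopfian S B"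
    and cyc: "cyclic_act S A" and f: "f \<in> act_End S A"
  shows "\<exists>n\<ge>1. (f ^^ n) ` carrier A = f ` (f ^^ n) ` carrier A"
proof -
  interpret right_act S A using cyc by (simp add: cyclic_act_def)
  obtain a where a: "a \<in> carrier A" and gen: "carrier A = (\<lambda>s. a \<odot>\<^bsub>A\<^esub> s) ` carrier S"
    using cyc by (auto simp: cyclic_act_def)
  note closed = act_End_closed[OF f] and smult = act_End_smult[OF f]
  define r where "r = (\<Union>n. act_ker A (f ^^ n))"
  have r_iff: "(x, y) \<in> r \<longleftrightarrow> x \<in> carrier A \<and> y \<in> carrier A \<and> (\<exists>n. (f ^^ n) x = (f ^^ n) y)" for x y
    by (auto simp: r_def act_ker_def)
  \<comment> \<open>Right to left, the induced map on classes is well defined; left to right, it is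
    injective.\<close>
  have r_f: "(f x, f y) \<in> r \<longleftrightarrow> (x, y) \<in> r" if "x \<in> carrier A" "y \<in> carrier A" for x y
  proof -
    have "(\<exists>n. (f ^^ n) (f x) = (f ^^ n) (f y)) \<longleftrightarrow> (\<exists>n. (f ^^ n) x = (f ^^ n) y)"
      by (metis comp_apply funpow.simps(2) funpow_swap1)
    then show ?thesis using that closed by (simp add: r_iff)
  qed
  obtain B :: "('a, 's) ract" and h where B: "cyclic_act S B" and h: "h \<in> act_hom S A B"
    and hB: "h ` carrier A = carrier B" and BA: "carrier B \<subseteq> carrier A"
    and hr: "\<And>x. x \<in> carrier A \<Longrightarrow> (h x, x) \<in> r"
    and h_eq: "\<And>x y. x \<in> carrier A \<Longrightarrow> y \<in> carrier A \<Longrightarrow> h x = h y \<longleftrightarrow> (x, y) \<in> r"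
    using cyclic_act_quotient[OF cyc act_congruence_Union_ker[OF f, folded r_def]] by blast
  have hcl: "h x \<in> carrier A" if "x \<in> carrier A" for x using hB BA that by blast
  have h_smult: "h (x \<odot>\<^bsub>A\<^esub> s) = h x \<odot>\<^bsub>B\<^esub> s" if "x \<in> carrier A" "s \<in> carrier S" for x s
    using h that by (auto simp: act_hom_def)
  \<comment> \<open>The endomorphism of the quotient induced by \<open>f\<close>: apply
    \<open>f\<close> to a representative, then return to the representative of the result.\<close>
  define g where "g = h \<circ> f"
  have g_h: "g (h x) = h (f x)" if "x \<in> carrier A" for x
    using that closed hcl hr by (simp add: g_def h_eq r_f)
  have "g \<in> act_End S B"
    unfolding act_End_def act_hom_def hB[symmetric]
    by (auto simp: g_h closed smult smult_closed simp flip: h_smult)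
  moreover have "inj_on g (carrier B)"
    unfolding hB[symmetric] by (rule inj_onI) (auto simp: g_h h_eq closed r_f)
  ultimately have "g ` carrier B = carrier B"
    using co B by (auto simp: co_hopfian_def act_Aut_def bij_betw_def)
  \<comment> \<open>Surjectivity of \<open>g\<close> is used only at the class of the generator
    \<open>a\<close>.\<close>
  then have "h a \<in> g ` h ` carrier A" using a hB by auto
  then obtain b where b: "b \<in> carrier A" "h a = h (f b)" using g_h by auto
  then obtain k where k: "(f ^^ k) a = (f ^^ k) (f b)"
    using a closed by (auto simp: h_eq r_iff)
  \<comment> \<open>The union of kernels includes the zeroth power, so \<open>k\<close> may be 0;
    the successor is a positive exponent.\<close>
  define n where "n = Suc k"
  have n: "(f ^^ n) a = f ((f ^^ n) b)"
    using k by (simp add: n_def funpow_swap1)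
  have fn: "f ^^ n \<in> act_End S A" using f by (rule act_End_funpow)
  \<comment> \<open>Acting by \<open>s\<close> carries the equation at \<open>a\<close> over to
    every element of \<open>aS\<close>.\<close>
  have "(f ^^ n) ` carrier A \<subseteq> f ` (f ^^ n) ` carrier A"
  proof
    fix y assume "y \<in> (f ^^ n) ` carrier A"
    then obtain s where s: "s \<in> carrier S" "y = (f ^^ n) (a \<odot>\<^bsub>A\<^esub> s)" using gen by auto
    then have "y = f ((f ^^ n) (b \<odot>\<^bsub>A\<^esub> s))"
      using a b n by (simp add: act_End_smult[OF fn] act_End_closed[OF fn] smult)
    then show "y \<in> f ` (f ^^ n) ` carrier A" using b s smult_closed by blast
  qed
  moreover have "f ` (f ^^ n) ` carrier A \<subseteq> (f ^^ n) ` carrier A"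
    using funpow_image_decreasing[OF f, of n "Suc n"] by (simp add: image_comp)
  ultimately have "(f ^^ n) ` carrier A = f ` (f ^^ n) ` carrier A" by (rule equalityI)
  moreover have "n \<ge> 1" by (simp add: n_def)
  ultimately show ?thesis by blast
qed

lemma bij_on_image_if_cyclic_hopfian:
  fixes A :: "('a, 's) ract"
  assumes hopf: "\<forall>B :: ('a, 's) ract. cyclic_act S B \<longrightarrow> hopfian S B \<and> co_hopfian S B"
    and cyc: "cyclic_act S A" and f: "f \<in> act_End S A"
  shows "\<exists>n\<ge>1. bij_betw f ((f ^^ n) ` carrier A) ((f ^^ n) ` carrier A)"
proof -
  interpret right_act S A using cyc by (simp add: cyclic_act_def)
  obtain n where n: "n \<ge> 1" and im: "(f ^^ n) ` carrier A = f ` (f ^^ n) ` carrier A"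
    using image_stationary_if_cyclic_co_hopfian[OF _ cyc f] hopf by blast
  define B where "B = A\<lparr>carrier := (f ^^ n) ` carrier A\<rparr>"
  have cB: "carrier B = (f ^^ n) ` carrier A" and sB: "\<And>x s. x \<odot>\<^bsub>B\<^esub> s = x \<odot>\<^bsub>A\<^esub> s"
    by (simp_all add: B_def)
  have fn: "f ^^ n \<in> act_End S A" using f by (rule act_End_funpow)
  have "cyclic_act S B" unfolding B_def using cyc fn by (rule cyclic_act_image)
  \<comment> \<open>The function \<open>f\<close> itself serves as its restriction, since values off
    the carrier are irrelevant.\<close>
  moreover have "f \<in> act_End S B"
    using im act_End_smult[OF f] act_End_closed[OF fn]
    by (auto simp: act_End_def act_hom_def cB sB)
  moreover have "f ` carrier B = carrier B" using im cB by simp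
  ultimately have "bij_betw f (carrier B) (carrier B)"
    using hopf by (auto simp: hopfian_def act_Aut_def)
  then show ?thesis using n cB by auto
qed

text \<open>The element type \<open>'a\<close> can stay fixed and arbitrary because the quotients
  and images to which the hypotheses are applied are again acts over \<open>'a\<close>.\<close>

theorem corollary3p15:
  fixes S :: "('s, 'm) monoid_scheme"
  assumes "monoid S"
  shows "((\<forall>A :: ('a, 's) ract. cyclic_act S A \<longrightarrow> hopfian S A \<and> co_hopfian S A)
            \<longleftrightarrow> (\<forall>A :: ('a, 's) ract. cyclic_act S A \<longrightarrow> fitting_act S A))
       \<and> ((\<forall>A :: ('a, 's) ract. cyclic_act S A \<longrightarrow> fitting_act S A)
            \<longleftrightarrow> (\<forall>A :: ('a, 's) ract. cyclic_act S A \<longrightarrow>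
                   strongly_hopfian S A \<and> strongly_co_hopfian S A))"
proof -
  have act: "right_act S A" if "cyclic_act S A" for A :: "('a, 's) ract"
    using that by (simp add: cyclic_act_def)
  note fitting = right_act.fitting_act_iff[OF act]
    and strong = right_act.strongly_hopfian_and_strongly_co_hopfian_iff[OF act]
    and hopf = right_act.hopfian_and_co_hopfian_if_bij_on_image[OF act]
  have "(\<forall>A :: ('a, 's) ract. cyclic_act S A \<longrightarrow> hopfian S A \<and> co_hopfian S A)
      \<longleftrightarrow> (\<forall>A :: ('a, 's) ract. cyclic_act S A \<longrightarrow> fitting_act S A)"
    using bij_on_image_if_cyclic_hopfian hopf fitting by meson
  moreover have "(\<forall>A :: ('a, 's) ract. cyclic_act S A \<longrightarrow> fitting_act S A)
      \<longleftrightarrow> (\<forall>A :: ('a, 's) ract. cyclic_act S A \<longrightarrow>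
             strongly_hopfian S A \<and> strongly_co_hopfian S A)"
    using fitting strong by blast
  ultimately show ?thesis by blast
qed

end
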